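(* Let $\sigma:(0,\infty)\to\mathbf{C}$ be a locally integrable function and let $\mu$ be a causal Lorentz invariant Borel complex measure on Minkowski space with $$\mu(\Gamma)=\int_{m=0}^{\infty}\sigma(m)\,\Omega_m^{+}(\Gamma)\,dm\qquad\text{for all }\Gamma\in\mathcal{B}_0(\mathbf{R}^4).$$ Then $\mu$ has a density with respect to Lebesgue measure on $\mathbf{R}^4$: for all $\Gamma\in\mathcal{B}_0(\mathbf{R}^4)$ $$\mu(\Gamma)=\int_{\Gamma}f(q)\,dq,$$ where $f:\mathbf{R}^4\to\mathbf{C}$ is defined by $f(q)=(q^2)^{-1/2}\sigma((q^2)^{1/2})$ if $q^2>0$ and $q^0>0$, and $f(q)=0$ otherwise.
   Context: $\mathcal{B}_0(\mathbf{R}^4)$ denotes the collection of relatively compact Borel subsets of $\mathbf{R}^4$. A Borel complex measure on Minkowski space is a map $\mu:\mathcal{B}_0(\mathbf{R}^4)\to\mathbf{C}$ such that for every $C\in\mathcal{B}_0(\mathbf{R}^4)$ its restriction to the Borel subsets of $C$ is a complex measure on $C$ in the usual sense. $\mathbf{R}^4$ carries the Minkowski form $q^2=(q^0)^2-(q^1)^2-(q^2)^2-(q^3)^2$ (the left-hand $q^2$ being the quadratic form), and $\vec q=\pi(q)=(q^1,q^2,q^3)$. For $m>0$ let $\omega_m(\vec p)=(m^2+|\vec p|^2)^{1/2}$, $H_m^{+}=\{p\in\mathbf{R}^4:p^2=m^2,\ p^0>0\}$ and $\Omega_m^{+}(\Gamma)=\int_{\pi(\Gamma\cap H_m^{+})}\frac{d\vec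 p}{\omega_m(\vec p)}$. *)

theory Defs
  imports "HOL-Analysis.Analysis"
begin

definition relcompact_borel :: "'a::topological_space set set" where
  "relcompact_borel = {\<Gamma> \<in> sets borel. compact (closure \<Gamma>)}"

definition complex_measure_on :: "'a measure \<Rightarrow> ('a set \<Rightarrow> complex) \<Rightarrow> bool" where
  "complex_measure_on M \<nu> \<longleftrightarrow>
     \<nu> {} = 0 \<and>
     (\<forall>A :: nat \<Rightarrow> 'a set. range A \<subseteq> sets M \<and> disjoint_family A \<longrightarrow>
        (\<lambda>i. \<nu> (A i)) sums \<nu> (\<Union>i. A i))"

text \<open>Only the values of \<open>\<mu>\<close> on relatively compact Borel sets are constrained; its values on
  all other sets are irrelevant and never used. From the measure \<open>restrict_space borel C\<close> only
  the \<open>\<sigma>\<close>-algebra of Borel subsets of \<open>C\<close> is used.\<close>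

definition borel_complex_measure :: "('a::topological_space set \<Rightarrow> complex) \<Rightarrow> bool" where
  "borel_complex_measure \<mu> \<longleftrightarrow>
     (\<forall>C \<in> relcompact_borel. complex_measure_on (restrict_space borel C) \<mu>)"

text \<open>The support of the total variation of \<open>\<mu>\<close>: an open set is null for the total variation
  iff \<open>\<mu>\<close> vanishes on all of its relatively compact Borel subsets.\<close>

definition measure_support :: "('a::topological_space set \<Rightarrow> complex) \<Rightarrow> 'a set" where
  "measure_support \<mu> =
     {x. \<forall>U. open U \<and> x \<in> U \<longrightarrow> (\<exists>\<Gamma> \<in> relcompact_borel. \<Gamma> \<subseteq> U \<and> \<mu> \<Gamma> \<noteq> 0)}"

definition locally_integrable_on :: "(real \<Rightarrow> complex) \<Rightarrow> real set \<Rightarrow> bool" where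
  "locally_integrable_on \<sigma> S \<longleftrightarrow>
     (\<forall>K. compact K \<and> K \<subseteq> S \<longrightarrow> set_integrable lebesgue K \<sigma>)"

text \<open>The four components of \<open>q :: real ^ 4\<close> are \<open>q $ 0\<close> (time) and \<open>q $ 1\<close>, \<open>q $ 2\<close>, \<open>q $ 3\<close>;
  in the index type \<open>4\<close> these four indices are distinct.\<close>

definition minkowski :: "real ^ 4 \<Rightarrow> real" where
  "minkowski q = (q $ 0)\<^sup>2 - (q $ 1)\<^sup>2 - (q $ 2)\<^sup>2 - (q $ 3)\<^sup>2"

definition spatial :: "real ^ 4 \<Rightarrow> real ^ 3" where
  "spatial q = vector [q $ 1, q $ 2, q $ 3]"

definition future_cone :: "(real ^ 4) set" where
  "future_cone = {q. minkowski q \<ge> 0 \<and> q $ 0 \<ge> 0}"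

definition causal :: "((real ^ 4) set \<Rightarrow> complex) \<Rightarrow> bool" where
  "causal \<mu> \<longleftrightarrow> measure_support \<mu> \<subseteq> future_cone"

text \<open>The proper orthochronous Lorentz group: the full group \<open>O(1,3)\<close> does not preserve the
  future cone.\<close>

definition lorentz_group :: "(real ^ 4 ^ 4) set" where
  "lorentz_group =
     {\<Lambda>. (\<forall>q. minkowski (\<Lambda> *v q) = minkowski q) \<and> det \<Lambda> = 1 \<and> \<Lambda> $ 0 $ 0 > 0}"

definition lorentz_invariant :: "((real ^ 4) set \<Rightarrow> complex) \<Rightarrow> bool" where
  "lorentz_invariant \<mu> \<longleftrightarrow>
     (\<forall>\<Lambda> \<in> lorentz_group. \<forall>\<Gamma> \<in> relcompact_borel. \<mu> ((\<lambda>q. \<Lambda> *v q) ` \<Gamma>) = \<mu> \<Gamma>)"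

definition energy :: "real \<Rightarrow> real ^ 3 \<Rightarrow> real" where
  "energy m p = sqrt (m\<^sup>2 + (norm p)\<^sup>2)"

definition mass_shell :: "real \<Rightarrow> (real ^ 4) set" where
  "mass_shell m = {p. minkowski p = m\<^sup>2 \<and> p $ 0 > 0}"

text \<open>Real-valued, hence meaningful only for sets of finite \<open>\<Omega>\<close>-measure, in particular for
  relatively compact Borel sets.\<close>

definition Omega :: "real \<Rightarrow> (real ^ 4) set \<Rightarrow> real" where
  "Omega m \<Gamma> = (LINT p : spatial ` (\<Gamma> \<inter> mass_shell m) | lborel. 1 / energy m p)"

definition spectral_density :: "(real \<Rightarrow> complex) \<Rightarrow> real ^ 4 \<Rightarrow> complex" where
  "spectral_density \<sigma> q =
     (if minkowski q > 0 \<and> q $ 0 > 0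
      then complex_of_real (minkowski q powr (-1/2)) * \<sigma> (minkowski q powr (1/2))
      else 0)"

end

(* The map (m, p) -> (energy m p, p) is a bijection from (0, infinity) x R^3 onto the open forward
   cone. For fixed p the substitution t = energy m p has dt = m / energy m p dm, so Lebesgue measure
   on the cone is the image of (m / energy m p) dm dp. Fubini, applied under this identification,
   turns the integral of the spectral density over a set into the given integral of \<sigma> against Omega;
   its absolute convergence is the assumed integrability, as Omega is nonnegative. Since \<sigma> is only
   Lebesgue measurable, it is first replaced by a Borel version: by the same identification, null sets
   of masses pull back to null sets of the cone. *)

theory Submission
  imports Defs
begin

section \<open>Time and space coordinates on Minkowski space\<close>

definition event :: "real \<Rightarrow> real ^ 3 \<Rightarrow> real ^ 4" where
  "event t p = (\<chi> i. if i = 1 then p $ 1 else if i = 2 then p $ 2 else if i = 3 then p $ 3 else t)"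

text \<open>The enumeration of the index type \<open>4\<close> lists its elements as 1, 2, 3, 4,
  whereas the time component carries the index 0; this identifies the two.\<close>

lemma four_eq_zero: "(4 :: 4) = 0"
  by simp

lemma event_nth [simp]:
  "event t p $ 0 = t" "event t p $ 1 = p $ 1" "event t p $ 2 = p $ 2" "event t p $ 3 = p $ 3"
  by (simp_all add: event_def)

lemma spatial_event [simp]: "spatial (event t p) = p"
  by (simp add: spatial_def vec_eq_iff forall_3)

lemma event_spatial: "event (q $ 0) (spatial q) = q"
  by (simp add: spatial_def vec_eq_iff forall_4 four_eq_zero)

lemma norm_power2_3: "(norm (p :: real ^ 3))\<^sup>2 = (p $ 1)\<^sup>2 + (p $ 2)\<^sup>2 + (p $ 3)\<^sup>2"
  by (simp add: norm_vec_def L2_set_def sum_3)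

lemma minkowski_event: "minkowski (event t p) = t\<^sup>2 - (norm p)\<^sup>2"
  by (simp add: minkowski_def norm_power2_3)

text \<open>Each component of \<open>event\<close> is a single coordinate of the pair of arguments,
  so \<open>event\<close> is continuous in the pair.\<close>

lemma measurable_event [measurable]:
  assumes [measurable]: "f \<in> borel_measurable M" "g \<in> borel_measurable M"
  shows "(\<lambda>x. event (f x) (g x)) \<in> borel_measurable M"
proof -
  have "continuous_on UNIV (\<lambda>z :: real \<times> (real ^ 3). event (fst z) (snd z))"
    unfolding event_def
  proof (rule continuous_on_vec_lambda)
    fix i :: 4
    show "continuous_on UNIV (\<lambda>z :: real \<times> (real ^ 3). if i = 1 then snd z $ 1
        else if i = 2 then snd z $ 2 else if i = 3 then snd z $ 3 else fst z)"
      by (cases "i = 1"; cases "i = 2"; cases "i = 3") (auto intro!: continuous_intros)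
  qed
  then have "(\<lambda>z :: real \<times> (real ^ 3). event (fst z) (snd z)) \<in> borel_measurable borel"
    by (rule borel_measurable_continuous_onI)
  from measurable_compose[OF _ this, of "\<lambda>x. (f x, g x)" M]
  show ?thesis by (simp add: borel_prod[symmetric])
qed

lemma prod_3: "prod f (UNIV :: 3 set) = f 1 * f 2 * f 3"
  unfolding UNIV_3 by (simp add: ac_simps)

lemma prod_4: "prod f (UNIV :: 4 set) = f 0 * f 1 * f 2 * f 3"
  unfolding UNIV_4 by (simp add: ac_simps four_eq_zero)

lemma Basis_cart_eq: "(Basis :: (real ^ 'n) set) = range (\<lambda>i. axis i 1)"
  by (auto simp: Basis_vec_def)

lemma prod_Basis_cart: "(\<Prod>b\<in>(Basis :: (real ^ 'n) set). x \<bullet> b) = (\<Prod>i\<in>UNIV. x $ i)"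
  unfolding Basis_cart_eq
  by (subst prod.reindex) (auto simp: inj_on_def axis_eq_axis inner_axis)

text \<open>Lebesgue measure is determined by its values on boxes. The preimage of a box under
  \<open>event\<close> is an interval times a spatial box, and the volumes multiply.\<close>

lemma lborel_eq_distr_event:
  "lborel = distr (lborel \<Otimes>\<^sub>M lborel) borel (\<lambda>(t, p). event t p)"
proof (rule lborel_eqI)
  fix l u :: "real ^ 4"
  assume le: "\<And>b. b \<in> Basis \<Longrightarrow> l \<bullet> b \<le> u \<bullet> b"
  have nth_le: "l $ i \<le> u $ i" for i
    using le[of "axis i 1"] by (simp add: Basis_cart_eq inner_axis)
  have pre: "(\<lambda>(t, p). event t p) -` box l u = box (l $ 0) (u $ 0) \<times> box (spatial l) (spatial u)"
    by (auto simp: mem_box_cart forall_4 forall_3 spatial_def four_eq_zero)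
  have "emeasure (distr (lborel \<Otimes>\<^sub>M lborel) borel (\<lambda>(t, p). event t p)) (box l u)
      = emeasure (lborel \<Otimes>\<^sub>M lborel) (box (l $ 0) (u $ 0) \<times> box (spatial l) (spatial u))"
    by (subst emeasure_distr) (simp_all add: pre space_pair_measure)
  also have "\<dots> = emeasure lborel (box (l $ 0) (u $ 0)) * emeasure lborel (box (spatial l) (spatial u))"
    by (rule lborel.emeasure_pair_measure_Times) auto
  also have "emeasure lborel (box (spatial l) (spatial u))
      = ennreal (\<Prod>b\<in>Basis. (spatial u - spatial l) \<bullet> b)"
  proof (rule emeasure_lborel_box)
    have "\<forall>i. spatial l $ i \<le> spatial u $ i" by (simp add: forall_3 spatial_def nth_le)
    then show "spatial l \<bullet> b \<le> spatial u \<bullet> b" if "b \<in> Basis" for b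
      using that by (auto simp: Basis_cart_eq inner_axis)
  qed
  also have "emeasure lborel (box (l $ 0) (u $ 0)) = ennreal (u $ 0 - l $ 0)"
    using nth_le[of 0] by (simp add: emeasure_lborel_box_eq)
  finally have eq: "emeasure (distr (lborel \<Otimes>\<^sub>M lborel) borel (\<lambda>(t, p). event t p)) (box l u)
      = ennreal (u $ 0 - l $ 0) * ennreal (\<Prod>b\<in>Basis. (spatial u - spatial l) \<bullet> b)" .
  show "emeasure (distr (lborel \<Otimes>\<^sub>M lborel) borel (\<lambda>(t, p). event t p)) (box l u)
      = ennreal (\<Prod>b\<in>Basis. (u - l) \<bullet> b)"
  proof -
    have "(\<Prod>b\<in>Basis. (u - l) \<bullet> b)
        = (u $ 0 - l $ 0) * (\<Prod>b\<in>Basis. (spatial u - spatial l) \<bullet> b)"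
      unfolding prod_Basis_cart prod_3 prod_4 by (simp add: spatial_def mult_ac)
    moreover have "0 \<le> u $ 0 - l $ 0" using nth_le[of 0] by simp
    ultimately show ?thesis
      using eq by (simp only: ennreal_mult')
  qed
qed simp

section \<open>The change of variables from energy to mass at fixed momentum\<close>

lemma tendsto_set_nn_integral_incseq:
  fixes h :: "'a \<Rightarrow> ennreal"
  assumes [measurable]: "h \<in> borel_measurable M" "\<And>n. K n \<in> sets M" and K: "incseq K"
  shows "(\<lambda>n. \<integral>\<^sup>+x. h x * indicator (K n) x \<partial>M) \<longlonglongrightarrow> (\<integral>\<^sup>+x. h x * indicator (\<Union>n. K n) x \<partial>M)"
proof (rule nn_integral_LIMSEQ)
  show "incseq (\<lambda>n x. h x * indicator (K n) x)"
    using K by (auto simp: incseq_def le_fun_def split: split_indicator)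
  fix x
  show "(\<lambda>n. h x * indicator (K n) x) \<longlonglongrightarrow> h x * indicator (\<Union>n. K n) x"
  proof (cases "\<exists>n. x \<in> K n")
    case True
    then obtain n where "x \<in> K n" ..
    with K have "\<forall>k\<ge>n. x \<in> K k" by (auto simp: incseq_def)
    then have "\<forall>\<^sub>F k in sequentially. h x * indicator (K k) x = h x * indicator (\<Union>n. K n) x"
      unfolding eventually_sequentially by (intro exI[of _ n]) (auto split: split_indicator)
    then show ?thesis by (rule tendsto_eventually)
  qed (simp add: indicator_def)
qed measurable

text \<open>Substitution t = sqrt (m^2 + r^2) with dt = (m / t) dm. The substitution rule needs a
  compact interval and a continuous derivative, and for r = 0 the derivative jumps at m = 0. So it
  is applied on compact intervals away from 0, and monotone convergence gives the
  half-lines.\<close>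

lemma nn_integral_mass_substitution:
  fixes f :: "real \<Rightarrow> real"
  assumes [measurable]: "f \<in> borel_measurable borel" and r: "r \<ge> 0"
  shows "(\<integral>\<^sup>+t. ennreal (f t) * indicator {r<..} t \<partial>lborel)
       = (\<integral>\<^sup>+m. ennreal (f (sqrt (m\<^sup>2 + r\<^sup>2)) * (m / sqrt (m\<^sup>2 + r\<^sup>2))) * indicator {0<..} m \<partial>lborel)"
proof -
  let ?g = "\<lambda>m. sqrt (m\<^sup>2 + r\<^sup>2)"
  \<comment> \<open>The \<open>I n\<close> exhaust the positive masses; \<open>J n\<close> is the
    interval between the images of the endpoints of \<open>I n\<close> under the increasing map
    \<open>?g\<close>.\<close>
  define I where "I n = {1 / real (Suc n)..real (Suc n)}" for n
  define J where "J n = {?g (1 / real (Suc n))..?g (real (Suc n))}" for n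
  have I_inc: "incseq I"
    unfolding I_def by (auto simp: incseq_def frac_le intro: order_trans[rotated])
  have J_inc: "incseq J"
    unfolding J_def incseq_def
    by (intro allI impI atLeastatMost_subset_iff[THEN iffD2] disjI2 conjI real_sqrt_le_mono
        add_right_mono power_mono frac_le) auto
  have in_I: "\<exists>n. m \<in> I n" if "m > 0" for m
  proof -
    from reals_Archimedean[OF that] obtain n1 where n1: "inverse (real (Suc n1)) < m" ..
    obtain n2 where n2: "m < real n2" using reals_Archimedean2 by blast
    have "inverse (real (Suc (max n1 n2))) \<le> inverse (real (Suc n1))" by (simp add: field_simps)
    with n1 n2 have "m \<in> I (max n1 n2)"
      unfolding I_def by (simp add: inverse_eq_divide)
    then show ?thesis ..
  qed
  have I_Un: "(\<Union>n. I n) = {0<..}"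
    using in_I by (auto simp: I_def intro: less_le_trans[rotated])
  have J_Un: "(\<Union>n. J n) = {r<..}"
  proof (intro equalityI subsetI)
    fix t assume "t \<in> (\<Union>n. J n)"
    then obtain n where n: "?g (1 / real (Suc n)) \<le> t" by (auto simp: J_def)
    have "r < ?g (1 / real (Suc n))"
      using r by (intro real_less_rsqrt) auto
    with n show "t \<in> {r<..}" by simp
  next
    fix t assume t: "t \<in> {r<..}"
    \<comment> \<open>The positive preimage of \<open>t\<close> under \<open>?g\<close>, that is,
      the mass with energy \<open>t\<close> at momentum length \<open>r\<close>. Monotonicity of
      \<open>?g\<close> carries m \<in> \<open>I n\<close> to t \<in> \<open>J n\<close>.\<close>
    define m where "m = sqrt (t\<^sup>2 - r\<^sup>2)"
    have "r\<^sup>2 < t\<^sup>2" using t r by (intro power_strict_mono) auto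
    then have m: "m > 0" "m\<^sup>2 = t\<^sup>2 - r\<^sup>2" by (auto simp: m_def)
    have tm: "t = ?g m" using t r m by simp
    obtain n where n: "1 / real (Suc n) \<le> m" "m \<le> real (Suc n)" using in_I[OF m(1)] by (auto simp: I_def)
    have "t \<in> J n" unfolding tm J_def atLeastAtMost_iff using n m(1)
      by (intro conjI real_sqrt_le_mono add_right_mono power_mono) auto
    then show "t \<in> (\<Union>n. J n)" by blast
  qed
  have eq: "(\<integral>\<^sup>+t. ennreal (f t) * indicator (J n) t \<partial>lborel)
      = (\<integral>\<^sup>+m. ennreal (f (?g m) * (m / ?g m)) * indicator (I n) m \<partial>lborel)" for n
    unfolding I_def J_def nn_integral_set_ennreal
  proof (rule nn_integral_substitution[where g = ?g and g' = "\<lambda>x. x / ?g x"])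
    fix x assume "x \<in> {1 / real (Suc n)..real (Suc n)}"
    then have "0 < 1 / real (Suc n)" "1 / real (Suc n) \<le> x" by auto
    then have x: "x > 0" by linarith
    then have "x\<^sup>2 + r\<^sup>2 > 0" by (simp add: add_pos_nonneg)
    moreover have "((\<lambda>m. m\<^sup>2 + r\<^sup>2) has_real_derivative 2 * x) (at x)"
      by (auto intro!: derivative_eq_intros)
    ultimately have "(?g has_real_derivative (inverse (?g x) / 2) * (2 * x)) (at x)"
      by (rule DERIV_chain2[OF DERIV_real_sqrt])
    moreover have "inverse s / 2 * (2 * y) = y / s" for s y :: real
      by (simp add: field_simps)
    ultimately show "(?g has_real_derivative x / ?g x) (at x)"
      by (simp only:)
    show "x / ?g x \<ge> 0" using x by simp
  next
    have "sqrt (x\<^sup>2 + r\<^sup>2) \<noteq> 0" if "x \<ge> 1 / real (Suc n)" for x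
    proof -
      have "0 < 1 / real (Suc n)" by simp
      then have "x > 0" using that by linarith
      then show ?thesis by simp
    qed
    then show "continuous_on {1 / real (Suc n)..real (Suc n)} (\<lambda>x. x / ?g x)"
      by (intro continuous_intros) auto
    show "1 / real (Suc n) \<le> real (Suc n)" by (simp add: field_simps)
  qed (simp add: set_borel_measurable_def)
  have [measurable]: "I n \<in> sets borel" "J n \<in> sets borel" for n
    by (simp_all add: I_def J_def)
  have "(\<lambda>n. \<integral>\<^sup>+t. ennreal (f t) * indicator (J n) t \<partial>lborel)
      \<longlonglongrightarrow> (\<integral>\<^sup>+t. ennreal (f t) * indicator (\<Union>n. J n) t \<partial>lborel)"
    by (rule tendsto_set_nn_integral_incseq[OF _ _ J_inc]) measurable
  moreover have "(\<lambda>n. \<integral>\<^sup>+m. ennreal (f (?g m) * (m / ?g m)) * indicator (I n) m \<partial>lborel)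
      \<longlonglongrightarrow> (\<integral>\<^sup>+m. ennreal (f (?g m) * (m / ?g m)) * indicator (\<Union>n. I n) m \<partial>lborel)"
    by (rule tendsto_set_nn_integral_incseq[OF _ _ I_inc]) measurable
  ultimately show ?thesis
    unfolding eq I_Un J_Un by (rule LIMSEQ_unique)
qed

section \<open>Lebesgue measure on the open forward cone in mass and momentum coordinates\<close>

definition forward_cone :: "(real ^ 4) set" where
  "forward_cone = {q. minkowski q > 0 \<and> q $ 0 > 0}"

lemma measurable_minkowski [measurable]: "minkowski \<in> borel_measurable borel"
  unfolding minkowski_def[abs_def] by measurable

lemma forward_cone_borel [measurable]: "forward_cone \<in> sets borel"
  unfolding forward_cone_def by measurable

text \<open>Over a fixed momentum the cone is a half-line in time, exactly the range of the mass
  substitution with \<open>r = norm p\<close>.\<close>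

lemma event_in_forward_cone: "event t p \<in> forward_cone \<longleftrightarrow> norm p < t"
proof -
  have "norm p < t \<longleftrightarrow> (norm p)\<^sup>2 < t\<^sup>2" if "t > 0"
    using that power_strict_mono[of "norm p" t 2] power2_less_imp_less[of "norm p" t] by auto
  moreover have "t > 0" if "norm p < t" using that norm_ge_zero[of p] by linarith
  ultimately show ?thesis by (auto simp: forward_cone_def minkowski_event)
qed

lemma measurable_energy [measurable]:
  assumes [measurable]: "f \<in> borel_measurable M" "g \<in> borel_measurable M"
  shows "(\<lambda>x. energy (f x) (g x)) \<in> borel_measurable M"
  unfolding energy_def by measurable

lemma energy_pos: "m > 0 \<Longrightarrow> energy m p > 0"
  by (simp add: energy_def add_pos_nonneg)

text \<open>After splitting off time, Tonelli makes the momentum the outer variable; the mass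
  substitution is applied for each momentum separately, and Tonelli reassembles the product.\<close>

lemma density_forward_cone:
  "density lborel (indicator forward_cone)
   = distr (density (lborel \<Otimes>\<^sub>M lborel) (\<lambda>(m, p). ennreal (indicator {0<..} m * (m / energy m p))))
       borel (\<lambda>(m, p). event (energy m p) p)" (is "?L = distr (density _ ?w) borel ?T")
proof (rule measure_eqI)
  fix A assume "A \<in> sets ?L"
  then have [measurable]: "A \<in> sets borel" by simp
  have sub: "(\<integral>\<^sup>+t. indicator forward_cone (event t p) * indicator A (event t p) \<partial>lborel)
      = (\<integral>\<^sup>+m. ennreal (indicator {0<..} m * (m / energy m p)) * indicator A (event (energy m p) p) \<partial>lborel)"
    for p
  proof -
    have "(\<integral>\<^sup>+t. indicator forward_cone (event t p) * indicator A (event t p) \<partial>lborel)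
        = (\<integral>\<^sup>+t. ennreal (indicator A (event t p)) * indicator {norm p<..} t \<partial>lborel)"
      by (intro nn_integral_cong) (auto simp: event_in_forward_cone split: split_indicator)
    also have "\<dots> = (\<integral>\<^sup>+m. ennreal (indicator A (event (energy m p) p) * (m / energy m p))
        * indicator {0<..} m \<partial>lborel)"
      unfolding energy_def by (rule nn_integral_mass_substitution) auto
    also have "\<dots> = (\<integral>\<^sup>+m. ennreal (indicator {0<..} m * (m / energy m p))
        * indicator A (event (energy m p) p) \<partial>lborel)"
      by (intro nn_integral_cong) (auto split: split_indicator)
    finally show ?thesis .
  qed
  have "emeasure ?L A = (\<integral>\<^sup>+q. indicator forward_cone q * indicator A q \<partial>lborel)"
    by (simp add: emeasure_density)
  also have "\<dots> = (\<integral>\<^sup>+(t, p). indicator forward_cone (event t p) * indicator A (event t p)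
      \<partial>(lborel \<Otimes>\<^sub>M lborel))"
    by (subst lborel_eq_distr_event, subst nn_integral_distr) (auto simp: split_beta')
  also have "\<dots> = (\<integral>\<^sup>+p. \<integral>\<^sup>+t. indicator forward_cone (event t p) * indicator A (event t p)
      \<partial>lborel \<partial>lborel)"
    by (subst lborel_pair.nn_integral_snd[symmetric]) auto
  also have "\<dots> = (\<integral>\<^sup>+(m, p). ennreal (indicator {0<..} m * (m / energy m p))
      * indicator A (event (energy m p) p) \<partial>(lborel \<Otimes>\<^sub>M lborel))"
    unfolding sub by (subst lborel_pair.nn_integral_snd[symmetric]) auto
  also have "\<dots> = emeasure (distr (density (lborel \<Otimes>\<^sub>M lborel) ?w) borel ?T) A"
  proof -
    have [measurable]: "?T \<in> borel_measurable (lborel \<Otimes>\<^sub>M lborel)" by measurable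
    have "?T -` A \<inter> space (lborel \<Otimes>\<^sub>M lborel) \<in> sets (lborel \<Otimes>\<^sub>M lborel)" by measurable
    then have "?T -` A \<in> sets (lborel \<Otimes>\<^sub>M lborel)" by (simp add: space_pair_measure)
    then show ?thesis
      by (subst emeasure_distr, simp, simp, subst emeasure_density)
        (auto simp: space_pair_measure split_beta' intro!: nn_integral_cong split: split_indicator)
  qed
  finally show "emeasure ?L A = emeasure (distr (density (lborel \<Otimes>\<^sub>M lborel) ?w) borel ?T) A" .
qed simp


section \<open>Null sets of masses, and the spectral density on mass shells\<close>

lemma minkowski_event_energy: "minkowski (event (energy m p) p) = m\<^sup>2"
  by (simp add: minkowski_event energy_def)

text \<open>A null set of masses times momentum space is null in the product. This survives the
  Jacobian weight and the push-forward to the cone, where the mass is recovered as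
  \<open>sqrt (minkowski q)\<close>.\<close>

lemma AE_forward_cone:
  assumes "AE m in lborel. P m"
  shows "AE q in lborel. q \<in> forward_cone \<longrightarrow> P (sqrt (minkowski q))"
proof -
  obtain N where N: "N \<in> null_sets lborel" and P: "\<And>m. m \<notin> N \<Longrightarrow> P m"
    using assms unfolding eventually_ae_filter by auto
  have [measurable]: "N \<in> sets borel" using N by auto
  have "AE x in lborel \<Otimes>\<^sub>M (lborel :: (real ^ 3) measure). fst x \<notin> N"
  proof (rule lborel_pair.AE_pair_measure)
    show "{x \<in> space (lborel \<Otimes>\<^sub>M lborel). fst x \<notin> N} \<in> sets (lborel \<Otimes>\<^sub>M (lborel :: (real ^ 3) measure))"
      by measurable
  qed (use AE_not_in[OF N] in auto)
  then have "AE x in density (lborel \<Otimes>\<^sub>M lborel) (\<lambda>(m, p). ennreal (indicator {0<..} m * (m / energy m p))).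
      case x of (m, p) \<Rightarrow> sqrt (minkowski (event (energy m p) p)) \<notin> N"
  \<comment> \<open>The condition only matters where the weight is positive; there m > 0, so the
    square root of m^2 is m itself.\<close>
  proof (subst AE_density)
    show "AE x in lborel \<Otimes>\<^sub>M lborel. 0 < (case x of (m, p) \<Rightarrow> ennreal (indicator {0<..} m * (m / energy m p)))
        \<longrightarrow> (case x of (m, p) \<Rightarrow> sqrt (minkowski (event (energy m p) p)) \<notin> N)"
      using \<open>AE x in lborel \<Otimes>\<^sub>M lborel. fst x \<notin> N\<close>
      by (rule eventually_mono)
        (simp add: split_beta' minkowski_event_energy indicator_def split: if_splits)
  qed (simp add: split_beta')
  then have "AE q in density lborel (indicator forward_cone). sqrt (minkowski q) \<notin> N"
    unfolding density_forward_cone by (subst AE_distr_iff) (auto simp: split_beta')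
  then have "AE q in lborel. q \<in> forward_cone \<longrightarrow> sqrt (minkowski q) \<notin> N"
    by (subst (asm) AE_density) (auto elim!: eventually_mono split: split_indicator_asm)
  then show ?thesis by (rule eventually_mono) (use P in auto)
qed

text \<open>The factor 1 / m is what cancels the m in the Jacobian \<open>m / energy m p\<close>,
  leaving the weight \<open>1 / energy m p\<close> of \<open>Omega\<close>.\<close>

lemma spectral_density_event_energy:
  "m > 0 \<Longrightarrow> spectral_density \<sigma> (event (energy m p) p) = complex_of_real (1 / m) * \<sigma> m"
  using energy_pos[of m p]
  by (simp add: spectral_density_def minkowski_event_energy powr_half_sqrt powr_minus inverse_eq_divide)

lemma spectral_density_eq_0: "q \<notin> forward_cone \<Longrightarrow> spectral_density \<sigma> q = 0"
  by (auto simp: spectral_density_def forward_cone_def)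

lemma spectral_density_borel:
  assumes [measurable]: "\<sigma> \<in> borel_measurable borel"
  shows "spectral_density \<sigma> \<in> borel_measurable borel"
  unfolding spectral_density_def[abs_def] by measurable

text \<open>Allows \<sigma> to be exchanged for a Borel version, since the density sees \<sigma>
  only through the mass of a point in the cone.\<close>

lemma AE_spectral_density_cong:
  assumes "AE m in lborel. m > 0 \<longrightarrow> \<sigma> m = \<tau> m"
  shows "AE q in lborel. spectral_density \<sigma> q = spectral_density \<tau> q"
  using AE_forward_cone[OF assms]
  by (rule eventually_mono) (auto simp: spectral_density_def forward_cone_def powr_half_sqrt)

section \<open>The shell measure as an integral over momentum space\<close>

lemma Omega_eq_integral:
  assumes "m > 0"
  shows "Omega m \<Gamma> = (\<integral>p. indicator \<Gamma> (event (energy m p) p) / energy m p \<partial>lborel)"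
proof -
  \<comment> \<open>On the shell the time component is the positive root determined by the momentum,
    so projecting to momentum loses nothing. The projected set is then the preimage of \<Gamma>
    under \<open>event (energy m p) p\<close>, a form that is visibly measurable jointly in mass and
    momentum.\<close>
  have "q $ 0 = energy m (spatial q)" if "q \<in> mass_shell m" for q
  proof -
    have "minkowski (event (q $ 0) (spatial q)) = m\<^sup>2" "q $ 0 > 0"
      using that by (simp_all add: event_spatial mass_shell_def)
    then have "m\<^sup>2 + (norm (spatial q))\<^sup>2 = (q $ 0)\<^sup>2" "q $ 0 > 0"
      by (simp_all add: minkowski_event)
    then show ?thesis by (simp add: energy_def)
  qed
  note shell = this
  have "p \<in> spatial ` (\<Gamma> \<inter> mass_shell m) \<longleftrightarrow> event (energy m p) p \<in> \<Gamma>" for p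
  proof
    assume "p \<in> spatial ` (\<Gamma> \<inter> mass_shell m)"
    then obtain q where q: "q \<in> \<Gamma>" "q \<in> mass_shell m" "p = spatial q" by auto
    then have "event (energy m p) p = q"
      using shell[OF q(2)] event_spatial[of q] by simp
    with q(1) show "event (energy m p) p \<in> \<Gamma>" by simp
  next
    assume "event (energy m p) p \<in> \<Gamma>"
    then show "p \<in> spatial ` (\<Gamma> \<inter> mass_shell m)"
      using energy_pos[OF assms, of p]
      by (intro image_eqI[of _ _ "event (energy m p) p"])
        (auto simp: mass_shell_def minkowski_event_energy)
  qed
  then have "indicator (spatial ` (\<Gamma> \<inter> mass_shell m)) p *\<^sub>R (1 / energy m p)
      = indicator \<Gamma> (event (energy m p) p) / energy m p" for p
    by (simp add: indicator_def)
  then show ?thesis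
    unfolding Omega_def set_lebesgue_integral_def by (simp only:)
qed

lemma norm_le_norm_event: "norm p \<le> norm (event t p)"
proof -
  have "(norm (event t p))\<^sup>2 = (norm p)\<^sup>2 + t\<^sup>2"
    by (simp add: norm_power2_3) (simp add: norm_vec_def L2_set_def sum_4 four_eq_zero)
  then have "(norm p)\<^sup>2 \<le> (norm (event t p))\<^sup>2" by simp
  then show ?thesis by (rule power2_le_imp_le) simp
qed

text \<open>Boundedness of \<Gamma> confines the momenta to a ball of finite volume, and the weight
  is at most 1 / m because the energy is at least m.\<close>

lemma integrable_Omega_integrand:
  assumes [measurable]: "\<Gamma> \<in> sets borel" and "bounded \<Gamma>" and m: "m > 0"
  shows "integrable lborel (\<lambda>p. indicator \<Gamma> (event (energy m p) p) / energy m p)"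
proof -
  obtain B where B: "\<And>q. q \<in> \<Gamma> \<Longrightarrow> norm q \<le> B"
    using \<open>bounded \<Gamma>\<close> by (auto simp: bounded_iff)
  have *: "norm p \<le> B" if "event (energy m p) p \<in> \<Gamma>" for p
    using B[OF that] norm_le_norm_event[of p "energy m p"] by linarith
  have "integrable lborel (\<lambda>p :: real ^ 3. indicator (cball 0 B) p *\<^sub>R
      (indicator \<Gamma> (event (energy m p) p) / energy m p))"
  proof (rule integrableI_bounded_set_indicator[where B = "1 / m"])
    have "m \<le> energy m p" for p
      unfolding energy_def by (rule real_le_rsqrt) simp
    then show "AE p in lborel. p \<in> cball 0 B \<longrightarrow>
        norm (indicator \<Gamma> (event (energy m p) p) / energy m p :: real) \<le> 1 / m"
      using m by (auto intro!: AE_I2 frac_le simp: abs_of_pos[OF energy_pos[OF m]] split: split_indicator)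
  qed (use emeasure_lborel_cball_finite[of "0 :: real ^ 3" B] in auto)
  also have "(\<lambda>p :: real ^ 3. indicator (cball 0 B) p *\<^sub>R
      (indicator \<Gamma> (event (energy m p) p) / energy m p))
      = (\<lambda>p. indicator \<Gamma> (event (energy m p) p) / energy m p)"
    using * by (auto simp: fun_eq_iff split: split_indicator)
  finally show ?thesis .
qed

section \<open>Measurability of \<sigma> and Borel versions\<close>

lemma lebesgue_ex_borel_measurable_complex:
  fixes f :: "'a::euclidean_space \<Rightarrow> complex"
  assumes [measurable]: "f \<in> borel_measurable lebesgue"
  obtains g where "g \<in> borel_measurable borel" "AE x in lborel. f x = g x"
proof -
  have "(\<lambda>x. Re (f x)) \<in> borel_measurable lebesgue" "(\<lambda>x. Im (f x)) \<in> borel_measurable lebesgue"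
    by measurable
  from this[THEN completion_ex_borel_measurable_real]
  obtain u v where uv [measurable]: "u \<in> borel_measurable borel" "v \<in> borel_measurable borel"
    and ae: "AE x in lborel. Re (f x) = u x" "AE x in lborel. Im (f x) = v x"
    by auto
  show thesis
  proof
    show "(\<lambda>x. Complex (u x) (v x)) \<in> borel_measurable borel"
      unfolding Complex_eq by measurable
    show "AE x in lborel. f x = Complex (u x) (v x)"
      using ae by eventually_elim (simp add: complex_eq_iff)
  qed
qed

text \<open>Local integrability yields measurability on each compact subinterval. An exhaustion of
  the positive half-line by such intervals makes the function a pointwise limit of measurable
  ones.\<close>

lemma locally_integrable_on_imp_measurable:
  assumes "locally_integrable_on \<sigma> {0<..}"
  shows "(\<lambda>m. indicator {0<..} m *\<^sub>R \<sigma> m) \<in> borel_measurable lebesgue"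
proof (rule borel_measurable_LIMSEQ_metric)
  define K where "K n = {1 / real (Suc n)..real (Suc n)}" for n
  have "K n \<subseteq> {0<..}" for n
    by (auto simp: K_def intro: less_le_trans[rotated])
  then have "set_integrable lebesgue (K n) \<sigma>" for n
    using assms unfolding locally_integrable_on_def by (simp add: K_def)
  then show "(\<lambda>m. indicator (K n) m *\<^sub>R \<sigma> m) \<in> borel_measurable lebesgue" for n
    unfolding set_integrable_def by (rule borel_measurable_integrable)
  fix m :: real
  show "(\<lambda>n. indicator (K n) m *\<^sub>R \<sigma> m) \<longlonglongrightarrow> indicator {0<..} m *\<^sub>R \<sigma> m"
  proof (cases "m > 0")
    case True
    have "(\<lambda>n. 1 / real (Suc n)) \<longlonglongrightarrow> 0"
      using LIMSEQ_inverse_real_of_nat by (simp add: inverse_eq_divide)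
    then have "\<forall>\<^sub>F n in sequentially. 1 / real (Suc n) < m"
      using True by (rule order_tendstoD)
    moreover have "\<forall>\<^sub>F n in sequentially. m \<le> real (Suc n)"
      using eventually_ge_at_top[of "nat \<lceil>m\<rceil>"] by eventually_elim linarith
    ultimately have "\<forall>\<^sub>F n in sequentially. indicator (K n) m *\<^sub>R \<sigma> m = indicator {0<..} m *\<^sub>R \<sigma> m"
      by eventually_elim (use True in \<open>simp add: K_def\<close>)
    then show ?thesis by (rule tendsto_eventually)
  next
    case False
    then have "m \<notin> K n" for n using \<open>K n \<subseteq> {0<..}\<close> by auto
    with False show ?thesis by simp
  qed
qed

section \<open>Fubini for Borel measurable \<sigma>\<close>

lemma has_bochner_integral_spectral_density_borel:
  assumes [measurable]: "\<sigma> \<in> borel_measurable borel" "\<Gamma> \<in> sets borel" and bounded: "bounded \<Gamma>"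
    and int: "has_bochner_integral lborel
      (\<lambda>m. indicator {0<..} m *\<^sub>R (\<sigma> m * complex_of_real (Omega m \<Gamma>))) c"
  shows "has_bochner_integral lborel (\<lambda>q. indicator \<Gamma> q *\<^sub>R spectral_density \<sigma> q) c"
proof -
  note spectral_density_borel[measurable]
  let ?w = "\<lambda>(m, p). indicator {0<..} m * (m / energy m p) :: real"
  let ?T = "\<lambda>(m, p). event (energy m p) p"
  let ?h = "\<lambda>q. indicator \<Gamma> q *\<^sub>R spectral_density \<sigma> q"
  \<comment> \<open>\<open>W m\<close> is the integrand of \<open>Omega m \<Gamma>\<close> over
    momentum space, and \<open>k\<close> is the integrand to which Fubini is applied.\<close>
  define W where "W m p = indicator \<Gamma> (event (energy m p) p) / energy m p" for m and p :: "real ^ 3"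
  define k where "k = (\<lambda>(m, p). W m p *\<^sub>R (indicator {0<..} m *\<^sub>R \<sigma> m))"
  have W_meas [measurable]: "(\<lambda>x. W (fst x) (snd x)) \<in> borel_measurable (lborel \<Otimes>\<^sub>M lborel)"
    unfolding W_def by measurable
  have k_meas [measurable]: "k \<in> borel_measurable (lborel \<Otimes>\<^sub>M lborel)"
    unfolding k_def split_beta' by measurable
  \<comment> \<open>The Jacobian times the pulled-back density is \<open>k\<close>: the powers of m
    cancel for m > 0, and the indicator makes both sides 0 for other m.\<close>
  have k_eq: "?w x *\<^sub>R ?h (?T x) = k x" for x
    using energy_pos[of "fst x" "snd x"]
    by (cases x) (auto simp: k_def W_def spectral_density_event_energy scaleR_conv_of_real
        split: split_indicator)
  have W_int: "integrable lborel (W m)" and W_Omega: "integral\<^sup>L lborel (W m) = Omega m \<Gamma>" if "m > 0" for m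
    using integrable_Omega_integrand[OF _ bounded that] Omega_eq_integral[OF that]
    by (simp_all add: W_def[abs_def])
  have W_nonneg: "W m p \<ge> 0" if "m > 0" for m p
    using energy_pos[OF that, of p] by (simp add: W_def)
  have k_int: "integrable lborel (\<lambda>p. k (m, p))" for m
    using W_int[of m] by (cases "m > 0") (auto simp: k_def)
  have k_integral: "(\<integral>p. k (m, p) \<partial>lborel) = indicator {0<..} m *\<^sub>R (\<sigma> m * complex_of_real (Omega m \<Gamma>))" for m
    using W_int[of m] W_Omega[of m] 
    by (cases "m > 0") (auto simp: k_def scaleR_conv_of_real mult.commute)
  \<comment> \<open>As \<open>W\<close> is nonnegative, the norm of \<sigma> comes out of the inner
    integral. Fubini's absolute integrability condition thus becomes the assumed integrability in
    m.\<close>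
  have k_norm: "(\<integral>p. norm (k (m, p)) \<partial>lborel)
      = norm (indicator {0<..} m *\<^sub>R (\<sigma> m * complex_of_real (Omega m \<Gamma>)))" for m
  proof (cases "m > 0")
    case True
    have "(\<integral>p. norm (k (m, p)) \<partial>lborel) = (\<integral>p. W m p * norm (\<sigma> m) \<partial>lborel)"
      using True W_nonneg[OF True] by (intro Bochner_Integration.integral_cong) (auto simp: k_def)
    also have "\<dots> = Omega m \<Gamma> * norm (\<sigma> m)"
      using W_Omega[OF True] by simp
    also have "\<dots> = norm (\<sigma> m * complex_of_real (Omega m \<Gamma>))"
      using W_nonneg[OF True] W_Omega[OF True, symmetric] by (simp add: norm_mult)
    finally show ?thesis using True by simp
  qed (simp add: k_def)
  have "integrable (lborel \<Otimes>\<^sub>M lborel) k"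
  proof (rule lborel_pair.Fubini_integrable)
    show "integrable lborel (\<lambda>m. \<integral>p. norm (k (m, p)) \<partial>lborel)"
      unfolding k_norm using int by (intro integrable_norm) (simp add: has_bochner_integral_iff)
  qed (use k_int in auto)
  moreover from this have "integral\<^sup>L (lborel \<Otimes>\<^sub>M lborel) k = (\<integral>m. \<integral>p. k (m, p) \<partial>lborel \<partial>lborel)"
    by (rule lborel_pair.integral_fst'[symmetric])
  ultimately have "has_bochner_integral (lborel \<Otimes>\<^sub>M lborel) (\<lambda>x. ?w x *\<^sub>R ?h (?T x)) c"
    using int unfolding k_eq by (simp add: k_integral has_bochner_integral_iff)
  \<comment> \<open>The weight moves into the measure, which is then pushed forward along
    \<open>?T\<close>; the result is Lebesgue measure on the cone.\<close>
  then have "has_bochner_integral (density (lborel \<Otimes>\<^sub>M lborel) (\<lambda>x. ennreal (?w x))) (\<lambda>x. ?h (?T x)) c"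
    by (intro has_bochner_integral_density)
      (auto simp: split_beta' less_imp_le energy_pos split: split_indicator)
  then have "has_bochner_integral (distr (density (lborel \<Otimes>\<^sub>M lborel) (\<lambda>x. ennreal (?w x))) borel ?T) ?h c"
    by (intro has_bochner_integral_distr) (auto simp: split_beta')
  also have "distr (density (lborel \<Otimes>\<^sub>M lborel) (\<lambda>x. ennreal (?w x))) borel ?T
      = density lborel (\<lambda>q. ennreal (indicator forward_cone q))"
    using density_forward_cone by (simp add: split_beta' ennreal_indicator)
  finally have "has_bochner_integral lborel (\<lambda>q. indicator forward_cone q *\<^sub>R ?h q) c"
    by (simp add: has_bochner_integral_iff integrable_density integral_density)
  also have "(\<lambda>q. indicator forward_cone q *\<^sub>R ?h q) = ?h"
    by (auto simp: spectral_density_eq_0 split: split_indicator)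
  finally show ?thesis .
qed

section \<open>From Borel to Lebesgue measurable \<sigma>\<close>

lemma has_bochner_integral_completion:
  fixes f :: "'a \<Rightarrow> 'b::{banach, second_countable_topology}"
  assumes "f \<in> borel_measurable M"
  shows "has_bochner_integral (completion M) f x \<longleftrightarrow> has_bochner_integral M f x"
  using assms by (simp add: has_bochner_integral_iff integrable_completion integral_completion)

theorem mainTheorem3:
  fixes \<sigma> :: "real \<Rightarrow> complex" and \<mu> :: "(real ^ 4) set \<Rightarrow> complex"
  assumes "locally_integrable_on \<sigma> {0<..}"
    and "borel_complex_measure \<mu>"
    and "causal \<mu>"
    and "lorentz_invariant \<mu>"
    and "\<And>\<Gamma>. \<Gamma> \<in> relcompact_borel \<Longrightarrow>
           has_bochner_integral (lebesgue_on {0<..})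
             (\<lambda>m. \<sigma> m * complex_of_real (Omega m \<Gamma>)) (\<mu> \<Gamma>)"
  shows "\<forall>\<Gamma> \<in> relcompact_borel.
           has_bochner_integral (lebesgue_on \<Gamma>) (spectral_density \<sigma>) (\<mu> \<Gamma>)"
proof
  fix \<Gamma> :: "(real ^ 4) set"
  assume \<Gamma>: "\<Gamma> \<in> relcompact_borel"
  then have [measurable]: "\<Gamma> \<in> sets borel" and bounded: "bounded \<Gamma>"
    by (auto simp: relcompact_borel_def dest: compact_imp_bounded intro: bounded_subset closure_subset)
  \<comment> \<open>\<tau> is a Borel version of \<sigma> extended by 0, so it agrees with \<sigma>
    at almost every positive mass.\<close>
  obtain \<tau> where \<tau> [measurable]: "\<tau> \<in> borel_measurable borel"
    and "AE m in lborel. indicator {0<..} m *\<^sub>R \<sigma> m = \<tau> m"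
    using locally_integrable_on_imp_measurable[OF assms(1)]
    by (rule lebesgue_ex_borel_measurable_complex)
  then have ae: "AE m in lborel. m > 0 \<longrightarrow> \<sigma> m = \<tau> m"
    by (auto elim!: eventually_mono)
  let ?f = "\<lambda>\<rho> m. indicator {0<..} m *\<^sub>R (\<rho> m * complex_of_real (Omega m \<Gamma>))"
  \<comment> \<open>Written as a parameter integral of a jointly measurable function,
    \<open>Omega m \<Gamma>\<close> is Borel measurable in m.\<close>
  have "?f \<tau> = (\<lambda>m. indicator {0<..} m *\<^sub>R (\<tau> m * complex_of_real
      (\<integral>p. indicator \<Gamma> (event (energy m p) p) / energy m p \<partial>lborel)))"
    by (auto simp: Omega_eq_integral split: split_indicator)
  then have f_meas: "?f \<tau> \<in> borel_measurable borel"
    by simp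
  \<comment> \<open>The hypothesis is moved to the whole line by an indicator, then from \<sigma> to
    \<tau>, and finally from Lebesgue to Borel measure, where the Fubini lemma applies.\<close>
  have "has_bochner_integral lebesgue (?f \<sigma>) (\<mu> \<Gamma>)"
    using assms(5)[OF \<Gamma>] by (subst (asm) has_bochner_integral_restrict_space) auto
  then have "has_bochner_integral lebesgue (?f \<tau>) (\<mu> \<Gamma>)"
  proof (rule has_bochner_integralI_AE)
    show "?f \<tau> \<in> borel_measurable lebesgue"
      using f_meas by (intro measurable_completion) simp
    show "AE m in lebesgue. ?f \<sigma> m = ?f \<tau> m"
      by (rule AE_completion) (use ae in \<open>auto elim!: eventually_mono split: split_indicator\<close>)
  qed
  then have "has_bochner_integral lborel (?f \<tau>) (\<mu> \<Gamma>)"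
    using f_meas by (simp add: has_bochner_integral_completion)
  then have "has_bochner_integral lborel (\<lambda>q. indicator \<Gamma> q *\<^sub>R spectral_density \<tau> q) (\<mu> \<Gamma>)"
    by (intro has_bochner_integral_spectral_density_borel bounded) auto
  then have int: "has_bochner_integral lebesgue (\<lambda>q. indicator \<Gamma> q *\<^sub>R spectral_density \<tau> q) (\<mu> \<Gamma>)"
    using spectral_density_borel[OF \<tau>] by (subst has_bochner_integral_completion) auto
  have ae': "AE q in lebesgue. indicator \<Gamma> q *\<^sub>R spectral_density \<tau> q = indicator \<Gamma> q *\<^sub>R spectral_density \<sigma> q"
    by (rule AE_completion)
      (use AE_spectral_density_cong[OF ae] in \<open>auto elim!: eventually_mono\<close>)
  \<comment> \<open>Returning from \<tau> to \<sigma>: completeness of Lebesgue measure gives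
    measurability of the \<sigma> integrand from its almost everywhere equality with the \<tau>
    integrand.\<close>
  have "has_bochner_integral lebesgue (\<lambda>q. indicator \<Gamma> q *\<^sub>R spectral_density \<sigma> q) (\<mu> \<Gamma>)"
    using int borel_measurable_AE[OF borel_measurable_has_bochner_integral[OF int] ae'] ae'
    by (rule has_bochner_integralI_AE)
  then show "has_bochner_integral (lebesgue_on \<Gamma>) (spectral_density \<sigma>) (\<mu> \<Gamma>)"
    by (subst has_bochner_integral_restrict_space) auto
qed

end
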